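(* Let $K$ be a field, let $>$ be a local degree ordering on the monomials in $x_1,\ldots,x_n$, and regard $K[x_1,\ldots,x_n]_>\subset K[[x_1,\ldots,x_n]]$, equipped with $>$. Let $G=\{g_1,\ldots,g_s\}$ be a subset of $K[x_1,\ldots,x_n]$ whose elements are nonzero and lie in the maximal ideal $\mathcal{M}$ of $K[[x_1,\ldots,x_n]]$. If $S\subset K[G]_>$ is a Sasbi basis of $K[G]_>$, then $S$ is a Sasbi basis of $K[[G]]$.
   Context: A monomial ordering is a total ordering $>$ on the set of monomials $\{x^\alpha \mid \alpha\in\mathbb{N}^n\}$ such that $x^\alpha>x^\beta$ implies $x^\gamma x^\alpha>x^\gamma x^\beta$ for all $\alpha,\beta,\gamma\in\mathbb{N}^n$. It is local if $x^\alpha<1$ for all $\alpha\neq 0$. It is a local degree ordering if it is local and $x^\alpha>x^\beta$ implies $\deg(x^\alpha)\le\deg(x^\beta)$. For a nonzero polynomial or, when $>$ is a local degree ordering, a nonzero power series $f$, $LM(f)$ denotes the largest monomial with respect to $>$ occurring in $f$ with nonzero coefficient. Put $S_>=\{u\in K[x_1,\ldots,x_n]\setminus\{0\}\mid LM(u)=1\}$ and $K[x_1,\ldots,x_n]_>=S_>^{-1}K[x_1,\ldots,x_n]$. For nonzero $f\in K[x_1,\ldots,x_n]_>$ define $LM(f)=LM(uf)$, where $u\in S_>$ is any element with $uf\in K[x_1,\ldots,x_n]$. For $G=\{g_1,\ldots,g_s\}\subset K[x_1,\ldots,x_n]$, $K[G]_>=(S_>\cap K[g_1,\ldots,g_s])^{-1}K[g_1,\ldots,g_s]$.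 For $G=\{g_1,\ldots,g_s\}\subset\mathcal{M}\setminus\{0\}$, $K[[G]]=\{Q(g_1,\ldots,g_s)\mid Q\in K[[y_1,\ldots,y_s]]\}$. For a set $S$, an $S$-monomial is a finite power product $S^\alpha=s_1^{\alpha_1}\cdots s_m^{\alpha_m}$ with $s_i\in S$, $m\in\mathbb{N}$, $\alpha\in\mathbb{N}^m$. A subset $S\subset K[G]_>$ is a Sasbi basis of $K[G]_>$ if for every $g\in K[G]_>\setminus\{0\}$ there is an $S$-monomial $S^\alpha$ with $LM(g)=LM(S^\alpha)$. Equivalently, the $K$-algebra generated by the leading monomials of all nonzero elements of $K[G]_>$ equals the $K$-algebra generated by the leading monomials of the elements of $S$. Likewise, a subset $S\subset K[[G]]$ is a Sasbi basis of $K[[G]]$ if for every $f\in K[[G]]\setminus\{0\}$ there is an $S$-monomial $S^\alpha$ with $LM(f)=LM(S^\alpha)$. *)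

theory Defs
  imports "HOL-Library.Poly_Mapping"
begin

section \<open>Multivariate formal power series\<close>

text \<open>
  A monomial \<open>x\<^sup>\<alpha>\<close> is represented by its exponent vector \<open>\<alpha> :: 'x \<Rightarrow>\<^sub>0 nat\<close>, so the monomial
  \<open>1\<close> is \<open>0\<close> and multiplication of monomials is \<open>+\<close>.  For an infinite variable type \<open>'x\<close>
  every monomial still involves finitely many variables only; \<open>vars_in\<close> below selects the
  power series over a prescribed set of variables.
\<close>

typedef ('x, 'a) mfps = "UNIV :: (('x \<Rightarrow>\<^sub>0 nat) \<Rightarrow> 'a) set"
  morphisms coeff Abs_mfps
  by simp

lemma coeff_Abs_mfps [simp]: "coeff (Abs_mfps f) = f"
  by (simp add: Abs_mfps_inverse)

lemma mfps_eqI: "(\<And>m. coeff f m = coeff g m) \<Longrightarrow> f = g"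
  by (simp add: coeff_inject[symmetric] ext)

lemma finite_splits: "finite {(a, b). a + b = (m :: 'x \<Rightarrow>\<^sub>0 nat)}"
proof -
  let ?A = "{f. \<forall>x. (x \<in> Poly_Mapping.keys m \<longrightarrow> f x \<in> {0..Max (insert 0 (range (Poly_Mapping.lookup m)))}) \<and>
                    (x \<notin> Poly_Mapping.keys m \<longrightarrow> f x = (0 :: nat))}"
  have finr: "finite (range (Poly_Mapping.lookup m))"
    by (rule finite_subset[of _ "insert 0 (Poly_Mapping.lookup m ` Poly_Mapping.keys m)"])
       (auto simp: in_keys_iff)
  have fin: "finite ?A"
    by (rule finite_set_of_finite_funs) auto
  have sub: "Poly_Mapping.lookup ` {a. \<exists>b. a + b = m} \<subseteq> ?A"
  proof safe
    fix a b :: "'x \<Rightarrow>\<^sub>0 nat" and x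
    assume m: "m = a + b"
    have "Poly_Mapping.lookup a x \<le> Poly_Mapping.lookup (a + b) x"
      by (simp add: lookup_add)
    also have "\<dots> \<le> Max (insert 0 (range (Poly_Mapping.lookup (a + b))))"
      using finr m by (intro Max_ge) auto
    finally show "Poly_Mapping.lookup a x
        \<in> {0..Max (insert 0 (range (Poly_Mapping.lookup (a + b))))}" by simp
  next
    fix a b :: "'x \<Rightarrow>\<^sub>0 nat" and x
    assume "x \<notin> Poly_Mapping.keys (a + b)"
    thus "Poly_Mapping.lookup a x = 0" by (simp add: in_keys_iff lookup_add)
  qed
  have "finite {a. \<exists>b. a + b = m}"
    by (rule finite_imageD[OF finite_subset[OF sub fin]]) (auto intro: inj_onI simp: lookup_inject)
  moreover have "finite {b. \<exists>a. a + b = m}"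
    using calculation by (simp add: add.commute)
  ultimately have "finite ({a. \<exists>b. a + b = m} \<times> {b. \<exists>a. a + b = m})" by blast
  thus ?thesis by (rule rev_finite_subset) auto
qed

instantiation mfps :: (type, comm_ring_1) comm_ring_1
begin

definition zero_mfps_def: "0 = Abs_mfps (\<lambda>_. 0)"
definition one_mfps_def: "1 = Abs_mfps (\<lambda>m. if m = 0 then 1 else 0)"
definition plus_mfps_def: "f + g = Abs_mfps (\<lambda>m. coeff f m + coeff g m)"
definition minus_mfps_def: "f - g = Abs_mfps (\<lambda>m. coeff f m - coeff g m)"
definition uminus_mfps_def: "- f = Abs_mfps (\<lambda>m. - coeff f m)"
definition times_mfps_def:
  "f * g = Abs_mfps (\<lambda>m. \<Sum>(a, b) \<in> {(a, b). a + b = m}. coeff f a * coeff g b)"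

lemma coeff_simps [simp]:
  "coeff 0 m = 0"
  "coeff 1 m = (if m = 0 then 1 else 0)"
  "coeff (f + g) m = coeff f m + coeff g m"
  "coeff (f - g) m = coeff f m - coeff g m"
  "coeff (- f) m = - coeff f m"
  by (simp_all add: zero_mfps_def one_mfps_def plus_mfps_def minus_mfps_def uminus_mfps_def)

lemma coeff_mult:
  "coeff (f * g) m = (\<Sum>(a, b) \<in> {(a, b). a + b = m}. coeff f a * coeff g b)"
  by (simp add: times_mfps_def)

instance
proof
  fix f g h :: "('a, 'b) mfps"
  show "f * g * h = f * (g * h)"
  proof (rule mfps_eqI)
    fix m
    have "coeff (f * g * h) m = (\<Sum>(p, c) \<in> {(p, c). p + c = m}.
        \<Sum>(a, b) \<in> {(a, b). a + b = p}. coeff f a * coeff g b * coeff h c)"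
      by (simp add: coeff_mult sum_distrib_right case_prod_beta)
    also have "\<dots> = (\<Sum>(a, q) \<in> {(a, q). a + q = m}.
        \<Sum>(b, c) \<in> {(b, c). b + c = q}. coeff f a * coeff g b * coeff h c)"
      unfolding case_prod_beta
      apply (subst sum.Sigma)
        apply (rule finite_splits[unfolded case_prod_beta])
       apply (intro ballI finite_splits[unfolded case_prod_beta])
      apply (subst sum.Sigma)
        apply (rule finite_splits[unfolded case_prod_beta])
       apply (intro ballI finite_splits[unfolded case_prod_beta])
      apply (rule sum.reindex_bij_witness
        [where i = "\<lambda>((a, q), (b, c)). ((a + b, c), (a, b))"
           and j = "\<lambda>((p, c), (a, b)). ((a, b + c), (b, c))"])
      by (auto simp: add.assoc)
    also have "\<dots> = coeff (f * (g * h)) m"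
      by (simp add: coeff_mult sum_distrib_left case_prod_beta mult.assoc)
    finally show "coeff (f * g * h) m = coeff (f * (g * h)) m" .
  qed
  show "f * g = g * f"
  proof (rule mfps_eqI)
    fix m
    show "coeff (f * g) m = coeff (g * f) m"
      unfolding coeff_mult
      by (rule sum.reindex_bij_witness[where i = prod.swap and j = prod.swap])
         (auto simp: add.commute mult.commute)
  qed
  show "1 * f = f"
  proof (rule mfps_eqI)
    fix m
    have "coeff (1 * f) m = (\<Sum>(a, b) \<in> {(0, m)}. coeff 1 a * coeff f b)"
      unfolding coeff_mult by (rule sum.mono_neutral_right) (auto intro: finite_splits split: if_splits)
    thus "coeff (1 * f) m = coeff f m" by simp
  qed
  show "(f + g) * h = f * h + g * h"
    by (rule mfps_eqI) (simp add: coeff_mult distrib_right sum.distrib case_prod_beta)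
  show "(0 :: ('a, 'b) mfps) \<noteq> 1"
    by (metis coeff_simps(1,2) zero_neq_one)
qed (auto intro!: mfps_eqI)

end

definition of_poly :: "(('x \<Rightarrow>\<^sub>0 nat) \<Rightarrow>\<^sub>0 'a::zero) \<Rightarrow> ('x, 'a) mfps" where
  "of_poly p = Abs_mfps (Poly_Mapping.lookup p)"

definition polynomials :: "('x, 'a::zero) mfps set" where
  "polynomials = range of_poly"

lemma polynomials_iff: "f \<in> polynomials \<longleftrightarrow> finite {m. coeff f m \<noteq> 0}"
proof
  assume "finite {m. coeff f m \<noteq> 0}"
  hence "f = of_poly (Abs_poly_mapping (coeff f))"
    by (simp add: of_poly_def coeff_inverse)
  thus "f \<in> polynomials" by (auto simp: polynomials_def)
qed (auto simp: polynomials_def of_poly_def)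

lemma inj_of_poly: "inj of_poly"
  by (auto simp: inj_def of_poly_def Abs_mfps_inject lookup_inject)

lemma of_poly_hom:
  fixes p q :: "('x \<Rightarrow>\<^sub>0 nat) \<Rightarrow>\<^sub>0 'a::comm_ring_1"
  shows "of_poly 1 = (1 :: ('x, 'a) mfps)"
    and "of_poly (p + q) = of_poly p + of_poly q"
    and "of_poly (p * q) = of_poly p * of_poly q"
proof -
  show "of_poly 1 = (1 :: ('x, 'a) mfps)"
    by (rule mfps_eqI) (simp add: of_poly_def lookup_one when_def)
  show "of_poly (p + q) = of_poly p + of_poly q"
    by (rule mfps_eqI) (simp add: of_poly_def lookup_add)
  show "of_poly (p * q) = of_poly p * of_poly q"
  proof (rule mfps_eqI)
    fix m
    have "coeff (of_poly (p * q)) m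
        = (\<Sum>(a, b). Poly_Mapping.lookup p a * Poly_Mapping.lookup q b when m = a + b)"
      by (simp add: of_poly_def times_poly_mapping.rep_eq prod_fun_unfold_prod)
    also have "\<dots> = (\<Sum>ab \<in> {(a, b). a + b = m}. case ab of (a, b) \<Rightarrow>
        (Poly_Mapping.lookup p a * Poly_Mapping.lookup q b when m = a + b))"
      by (rule Sum_any.expand_superset[OF finite_splits]) (auto simp: when_def split: if_splits)
    also have "\<dots> = coeff (of_poly p * of_poly q) m"
      unfolding coeff_mult by (rule sum.cong) (auto simp: of_poly_def)
    finally show "coeff (of_poly (p * q)) m = coeff (of_poly p * of_poly q) m" .
  qed
qed

definition mdeg :: "('x \<Rightarrow>\<^sub>0 nat) \<Rightarrow> nat" where
  "mdeg \<alpha> = (\<Sum>i \<in> Poly_Mapping.keys \<alpha>. Poly_Mapping.lookup \<alpha> i)"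

lemma mdeg_add: "mdeg (\<alpha> + \<beta>) = mdeg \<alpha> + mdeg \<beta>"
proof -
  let ?V = "Poly_Mapping.keys \<alpha> \<union> Poly_Mapping.keys \<beta>"
  have "mdeg \<gamma> = (\<Sum>i \<in> ?V. Poly_Mapping.lookup \<gamma> i)" if "Poly_Mapping.keys \<gamma> \<subseteq> ?V" for \<gamma>
    unfolding mdeg_def using that by (intro sum.mono_neutral_left) (auto simp: in_keys_iff)
  from this[of \<alpha>] this[of \<beta>] this[of "\<alpha> + \<beta>"] show ?thesis
    by (simp add: lookup_add sum.distrib keys_add)
qed

lemma mdeg_eq_0_iff: "mdeg \<alpha> = 0 \<longleftrightarrow> \<alpha> = 0"
  by (auto simp: mdeg_def in_keys_iff intro!: poly_mapping_eqI)

definition max_ideal :: "('x, 'a::zero) mfps set" where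
  "max_ideal = {f. coeff f 0 = 0}"

lemma coeff_mult_0: "coeff (f * g) 0 = coeff f 0 * coeff g (0 :: 'x \<Rightarrow>\<^sub>0 nat)"
proof -
  have "a + b = 0 \<longleftrightarrow> a = 0 \<and> b = 0" for a b :: "'x \<Rightarrow>\<^sub>0 nat"
    by (metis add_is_0 mdeg_add mdeg_eq_0_iff)
  hence "{(a, b :: 'x \<Rightarrow>\<^sub>0 nat). a + b = 0} = {(0, 0)}" by auto
  thus ?thesis by (simp add: coeff_mult)
qed

function inv_coeff :: "('x, 'a::field) mfps \<Rightarrow> ('x \<Rightarrow>\<^sub>0 nat) \<Rightarrow> 'a" where
  "inv_coeff f m = (if m = 0 then 1 / coeff f 0 else
     - (\<Sum>ab \<in> {ab. fst ab + snd ab = m \<and> fst ab \<noteq> 0}. coeff f (fst ab) * inv_coeff f (snd ab)) / coeff f 0)"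
  by auto
termination
  by (relation "measure (\<lambda>(f, m). mdeg m)") (auto simp: mdeg_add mdeg_eq_0_iff neq0_conv[symmetric])

declare inv_coeff.simps [simp del]

lemma mult_inv_coeff:
  assumes "coeff f 0 \<noteq> 0"
  shows "f * Abs_mfps (inv_coeff f) = 1"
proof (rule mfps_eqI)
  fix m
  show "coeff (f * Abs_mfps (inv_coeff f)) m = coeff 1 m"
  proof (cases "m = 0")
    case True
    thus ?thesis using assms by (simp add: coeff_mult_0 inv_coeff.simps[of _ 0])
  next
    case False
    let ?A = "{ab. fst ab + snd ab = m \<and> fst ab \<noteq> 0}"
    have split: "{(a, b). a + b = m} = insert (0, m) ?A" by auto
    have "finite ?A" by (rule finite_subset[OF _ finite_splits[of m]]) auto
    hence "coeff (f * Abs_mfps (inv_coeff f)) m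
        = coeff f 0 * inv_coeff f m + (\<Sum>ab \<in> ?A. coeff f (fst ab) * inv_coeff f (snd ab))"
      unfolding coeff_mult split by (simp add: case_prod_beta)
    also have "\<dots> = 0"
      using assms False by (simp add: inv_coeff.simps[of _ m])
    finally show ?thesis using False by simp
  qed
qed

text \<open>So \<^const>\<open>max_ideal\<close> is the set of non-units, that is, the unique maximal ideal.\<close>

lemma max_ideal_iff: "f \<in> max_ideal \<longleftrightarrow> \<not> f dvd (1 :: ('x, 'a::field) mfps)"
proof
  assume "f \<in> max_ideal"
  thus "\<not> f dvd 1"
    by (metis (mono_tags, lifting) coeff_mult_0 coeff_simps(2) dvdE max_ideal_def mem_Collect_eq
        mult_zero_left zero_neq_one)
next
  assume "\<not> f dvd 1"
  thus "f \<in> max_ideal"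
    using mult_inv_coeff[of f] by (metis (mono_tags, lifting) dvdI max_ideal_def mem_Collect_eq)
qed

definition vars_in :: "'x set \<Rightarrow> ('x, 'a::zero) mfps \<Rightarrow> bool" where
  "vars_in V Q \<longleftrightarrow> (\<forall>\<beta>. coeff Q \<beta> \<noteq> 0 \<longrightarrow> Poly_Mapping.keys \<beta> \<subseteq> V)"

text \<open>
  The substitution \<open>Q(g) = \<Sum>\<^sub>\<beta> Q\<^sub>\<beta> g\<^sup>\<beta>\<close>, formed coefficientwise.  Note that \<^const>\<open>Sum_any\<close> is
  \<open>0\<close> for infinite support: the definition is meaningful if \<open>Q\<close> is a polynomial, or if \<open>Q\<close>
  involves finitely many variables \<open>y\<^sub>i\<close> only and the corresponding \<open>g i\<close> lie in the maximal
  ideal, because then only finitely many \<open>g\<^sup>\<beta>\<close> contribute to each coefficient.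
\<close>

definition subst :: "('y \<Rightarrow> ('x, 'a::comm_ring_1) mfps) \<Rightarrow> ('y, 'a) mfps \<Rightarrow> ('x, 'a) mfps" where
  "subst g Q = Abs_mfps (\<lambda>\<alpha>. \<Sum>\<beta>.
     coeff Q \<beta> * coeff (\<Prod>i \<in> Poly_Mapping.keys \<beta>. g i ^ Poly_Mapping.lookup \<beta> i) \<alpha>)"


section \<open>Monomial orderings and leading monomials\<close>

definition monomial_ordering :: "(('x \<Rightarrow>\<^sub>0 nat) \<Rightarrow> ('x \<Rightarrow>\<^sub>0 nat) \<Rightarrow> bool) \<Rightarrow> bool" where
  "monomial_ordering gt \<longleftrightarrow> irreflp gt \<and> transp gt \<and> totalp gt \<and>
     (\<forall>\<alpha> \<beta> \<gamma>. gt \<alpha> \<beta> \<longrightarrow> gt (\<gamma> + \<alpha>) (\<gamma> + \<beta>))"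

definition local_ordering :: "(('x \<Rightarrow>\<^sub>0 nat) \<Rightarrow> ('x \<Rightarrow>\<^sub>0 nat) \<Rightarrow> bool) \<Rightarrow> bool" where
  "local_ordering gt \<longleftrightarrow> monomial_ordering gt \<and> (\<forall>\<alpha>. \<alpha> \<noteq> 0 \<longrightarrow> gt 0 \<alpha>)"

definition local_degree_ordering :: "(('x \<Rightarrow>\<^sub>0 nat) \<Rightarrow> ('x \<Rightarrow>\<^sub>0 nat) \<Rightarrow> bool) \<Rightarrow> bool" where
  "local_degree_ordering gt \<longleftrightarrow> local_ordering gt \<and> (\<forall>\<alpha> \<beta>. gt \<alpha> \<beta> \<longrightarrow> mdeg \<alpha> \<le> mdeg \<beta>)"

text \<open>Only meaningful if \<open>f\<close> has a largest monomial; in particular \<open>f \<noteq> 0\<close>.\<close>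

definition LM :: "(('x \<Rightarrow>\<^sub>0 nat) \<Rightarrow> ('x \<Rightarrow>\<^sub>0 nat) \<Rightarrow> bool) \<Rightarrow> ('x, 'a::zero) mfps \<Rightarrow> ('x \<Rightarrow>\<^sub>0 nat)" where
  "LM gt f = (THE \<alpha>. coeff f \<alpha> \<noteq> 0 \<and> (\<forall>\<beta>. coeff f \<beta> \<noteq> 0 \<and> \<beta> \<noteq> \<alpha> \<longrightarrow> gt \<alpha> \<beta>))"


section \<open>Localizations and subalgebras\<close>

text \<open>
  \<open>fractions U A\<close> is the image of \<open>U\<inverse> A\<close> in the power series ring.  It is used for multiplicative
  sets \<open>U\<close> consisting of units of that ring, so that \<open>h\<close> with \<open>u * h = f\<close> is the unique
  element \<open>f / u\<close>.
\<close>

definition fractions :: "('x, 'a::comm_ring_1) mfps set \<Rightarrow> ('x, 'a) mfps set \<Rightarrow> ('x, 'a) mfps set" where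
  "fractions U A = {h. \<exists>u \<in> U. \<exists>f \<in> A. u * h = f}"

definition loc_units ::
    "(('x \<Rightarrow>\<^sub>0 nat) \<Rightarrow> ('x \<Rightarrow>\<^sub>0 nat) \<Rightarrow> bool) \<Rightarrow> ('x, 'a::comm_ring_1) mfps set" where
  "loc_units gt = {u \<in> polynomials - {0}. LM gt u = 0}"

lemma loc_units_dvd_1:
  fixes u :: "('x, 'a::field) mfps"
  assumes gt: "local_ordering gt" and u: "u \<in> loc_units gt"
  shows "u dvd 1"
proof -
  let ?P = "\<lambda>\<alpha>. coeff u \<alpha> \<noteq> 0 \<and> (\<forall>\<beta>. coeff u \<beta> \<noteq> 0 \<and> \<beta> \<noteq> \<alpha> \<longrightarrow> gt \<alpha> \<beta>)"
  have irr: "\<not> gt \<alpha> \<alpha>" and tr: "gt \<alpha> \<beta> \<Longrightarrow> gt \<beta> \<gamma> \<Longrightarrow> gt \<alpha> \<gamma>"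
    and tot: "\<alpha> \<noteq> \<beta> \<Longrightarrow> gt \<alpha> \<beta> \<or> gt \<beta> \<alpha>" for \<alpha> \<beta> \<gamma>
    using gt unfolding local_ordering_def monomial_ordering_def
    by (auto dest: irreflpD transpD totalpD)
  have max: "\<exists>\<alpha> \<in> A. \<forall>\<beta> \<in> A. \<beta> \<noteq> \<alpha> \<longrightarrow> gt \<alpha> \<beta>" if "finite A" "A \<noteq> {}" for A
    using that
  proof (induction rule: finite_ne_induct)
    case (insert x F)
    then obtain \<alpha> where \<alpha>: "\<alpha> \<in> F" "\<forall>\<beta> \<in> F. \<beta> \<noteq> \<alpha> \<longrightarrow> gt \<alpha> \<beta>" by blast
    show ?case
    proof (cases "gt \<alpha> x")
      case True
      with \<alpha> show ?thesis by (intro bexI[of _ \<alpha>]) auto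
    next
      case False
      moreover have "\<alpha> \<noteq> x" using \<alpha> insert.hyps by auto
      ultimately have "gt x \<alpha>" using tot by blast
      with \<alpha> tr show ?thesis by (intro bexI[of _ x]) (simp, metis insertE, simp)
    qed
  qed auto
  have "finite {m. coeff u m \<noteq> 0}" "{m. coeff u m \<noteq> 0} \<noteq> {}"
    using u by (auto simp: loc_units_def polynomials_iff intro: mfps_eqI)
  from max[OF this] obtain \<alpha> where \<alpha>: "?P \<alpha>" by auto
  hence "LM gt u = \<alpha>" unfolding LM_def using irr tr by (intro the_equality) (auto, metis)
  with u \<alpha> have "coeff u 0 \<noteq> 0" by (simp add: loc_units_def)
  thus ?thesis using mult_inv_coeff[of u] by (metis dvdI)
qed

definition loc_polynomials ::
    "(('x \<Rightarrow>\<^sub>0 nat) \<Rightarrow> ('x \<Rightarrow>\<^sub>0 nat) \<Rightarrow> bool) \<Rightarrow> ('x, 'a::comm_ring_1) mfps set" where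
  "loc_polynomials gt = fractions (loc_units gt) polynomials"

text \<open>The leading monomial on \<^const>\<open>loc_polynomials\<close>, obtained by clearing denominators.\<close>

definition LM_loc ::
    "(('x \<Rightarrow>\<^sub>0 nat) \<Rightarrow> ('x \<Rightarrow>\<^sub>0 nat) \<Rightarrow> bool) \<Rightarrow> ('x, 'a::comm_ring_1) mfps \<Rightarrow> ('x \<Rightarrow>\<^sub>0 nat)" where
  "LM_loc gt f = LM gt ((SOME u. u \<in> loc_units gt \<and> u * f \<in> polynomials) * f)"

text \<open>
  The three algebras attached to \<open>g 1, \<dots>, g s\<close>: \<open>K[g\<^sub>1,\<dots>,g\<^sub>s]\<close>, \<open>K[G]\<^sub>>\<close> and \<open>K[[G]]\<close>.
  The auxiliary variables are \<open>y\<^sub>i\<close> with \<open>i \<in> {1..s}\<close>.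
\<close>

definition poly_alg :: "nat \<Rightarrow> (nat \<Rightarrow> ('x, 'a::comm_ring_1) mfps) \<Rightarrow> ('x, 'a) mfps set" where
  "poly_alg s g = {subst g Q | Q. Q \<in> polynomials \<and> vars_in {1..s} Q}"

definition loc_alg ::
    "(('x \<Rightarrow>\<^sub>0 nat) \<Rightarrow> ('x \<Rightarrow>\<^sub>0 nat) \<Rightarrow> bool) \<Rightarrow> nat \<Rightarrow> (nat \<Rightarrow> ('x, 'a::comm_ring_1) mfps) \<Rightarrow>
     ('x, 'a) mfps set" where
  "loc_alg gt s g = fractions (loc_units gt \<inter> poly_alg s g) (poly_alg s g)"

definition power_series_alg :: "nat \<Rightarrow> (nat \<Rightarrow> ('x, 'a::comm_ring_1) mfps) \<Rightarrow> ('x, 'a) mfps set" where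
  "power_series_alg s g = {subst g Q | Q. vars_in {1..s} Q}"


section \<open>Sasbi bases\<close>

definition power_products :: "('x, 'a::comm_ring_1) mfps set \<Rightarrow> ('x, 'a) mfps set" where
  "power_products S = {\<Prod>i = 1..m. t i ^ \<alpha> i | (m :: nat) t (\<alpha> :: nat \<Rightarrow> nat). \<forall>i \<in> {1..m}. t i \<in> S}"

text \<open>
  The first argument is the leading monomial function in force on \<open>A\<close>.  Since \<open>S\<close> may contain
  \<open>0\<close>, the condition \<open>p \<noteq> 0\<close> is needed for the leading monomial of \<open>p\<close> to be defined.
\<close>

definition sasbi_basis ::
    "(('x, 'a::comm_ring_1) mfps \<Rightarrow> ('x \<Rightarrow>\<^sub>0 nat)) \<Rightarrow> ('x, 'a) mfps set \<Rightarrow> ('x, 'a) mfps set \<Rightarrow> bool" where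
  "sasbi_basis lm A S \<longleftrightarrow> S \<subseteq> A \<and>
     (\<forall>f \<in> A - {0}. \<exists>p \<in> power_products S. p \<noteq> 0 \<and> lm f = lm p)"

end

theory Submission
  imports Defs
begin

text \<open>
  Let \<open>f = Q(g)\<close> be a nonzero element of \<open>K[[G]]\<close> with leading monomial \<open>\<alpha>\<close>, and let \<open>Q'\<close> be the
  part of \<open>Q\<close> of degree at most \<open>deg \<alpha>\<close>.  Since every \<open>g\<^sub>i\<close> has zero constant term, \<open>g\<^sup>\<beta>\<close> only has
  terms of degree at least \<open>|\<beta>|\<close>, so \<open>f\<close> and the polynomial \<open>f' = Q'(g)\<close> have the same terms up to
  degree \<open>deg \<alpha>\<close> (\<open>coeff_subst_cong\<close>).  In a local degree ordering terms of higher degree are smaller,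
  hence \<open>f'\<close> has leading monomial \<open>\<alpha>\<close> too (\<open>LM_cong_upto_degree\<close>).  As \<open>f'\<close> lies in \<open>K[G]\<^sub>>\<close>, some
  \<open>S\<close>-monomial has leading monomial \<open>\<alpha>\<close>.

  Two compatibilities remain.  First, the leading monomial on \<open>K[x]\<^sub>>\<close>, defined by clearing
  denominators, must agree with the one of power series; this is multiplicativity of \<open>LM\<close>,
  because denominators have leading monomial \<open>1\<close> (\<open>LM_loc_eq_LM\<close>).  Secondly, \<open>S\<close> must be contained in
  \<open>K[[G]]\<close>.  A denominator \<open>U(g)\<close> is a unit, and its constant term is that of \<open>U\<close>; so \<open>U\<close> has an
  inverse power series \<open>V\<close> in the same variables, and \<open>F(g) / U(g) = (V F)(g)\<close>, as substitution is
  multiplicative (\<open>subst_mult\<close>, \<open>loc_alg_subset_power_series_alg\<close>).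
\<close>

section \<open>Degrees and orders of power series\<close>

lemma finite_bounded_degree:
  assumes "finite A"
  shows "finite {\<beta> :: 'y \<Rightarrow>\<^sub>0 nat. Poly_Mapping.keys \<beta> \<subseteq> A \<and> mdeg \<beta> \<le> d}" (is "finite ?B")
proof -
  let ?F = "{h. \<forall>x. (x \<in> A \<longrightarrow> h x \<in> {0..d}) \<and> (x \<notin> A \<longrightarrow> h x = (0 :: nat))}"
  have "finite ?F"
    using assms by (rule finite_set_of_finite_funs) auto
  moreover have "Poly_Mapping.lookup ` ?B \<subseteq> ?F"
  proof safe
    fix \<beta> :: "'y \<Rightarrow>\<^sub>0 nat" and x
    assume "mdeg \<beta> \<le> d"
    moreover have "Poly_Mapping.lookup \<beta> x \<le> mdeg \<beta>"
      by (cases "x \<in> Poly_Mapping.keys \<beta>") (auto simp: mdeg_def in_keys_iff intro: member_le_sum)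
    ultimately show "Poly_Mapping.lookup \<beta> x \<in> {0..d}" by simp
  next
    fix \<beta> :: "'y \<Rightarrow>\<^sub>0 nat" and x
    assume "Poly_Mapping.keys \<beta> \<subseteq> A" "x \<notin> A"
    thus "Poly_Mapping.lookup \<beta> x = 0" by (auto simp: in_keys_iff)
  qed
  ultimately have "finite (Poly_Mapping.lookup ` ?B)" by (rule rev_finite_subset)
  thus ?thesis
    by (rule finite_imageD) (auto intro: inj_onI simp: lookup_inject)
qed

text \<open>
  In finitely many variables this is membership in the \<open>k\<close>-th power of the maximal ideal.
\<close>

definition order_ge :: "nat \<Rightarrow> ('x, 'a::zero) mfps \<Rightarrow> bool" where
  "order_ge k f \<longleftrightarrow> (\<forall>\<alpha>. mdeg \<alpha> < k \<longrightarrow> coeff f \<alpha> = 0)"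

lemma order_ge_0 [simp]: "order_ge 0 f"
  by (simp add: order_ge_def)

lemma order_ge_1: "f \<in> max_ideal \<Longrightarrow> order_ge 1 f"
  by (auto simp: order_ge_def max_ideal_def mdeg_eq_0_iff)

lemma order_ge_mult:
  assumes "order_ge k f" "order_ge l h"
  shows "order_ge (k + l) (f * h)"
  unfolding order_ge_def coeff_mult
proof (intro allI impI sum.neutral ballI)
  fix \<alpha> and ab :: "('a \<Rightarrow>\<^sub>0 nat) \<times> ('a \<Rightarrow>\<^sub>0 nat)"
  assume "mdeg \<alpha> < k + l" "ab \<in> {(a, b). a + b = \<alpha>}"
  then obtain a b where ab: "ab = (a, b)" "mdeg a + mdeg b < k + l"
    by (auto simp: mdeg_add)
  hence "mdeg a < k \<or> mdeg b < l" by linarith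
  thus "(case ab of (a, b) \<Rightarrow> coeff f a * coeff h b) = 0"
    using assms ab by (auto simp: order_ge_def)
qed

lemma order_ge_power: "f \<in> max_ideal \<Longrightarrow> order_ge n (f ^ n)"
proof (induction n)
  case (Suc n)
  thus ?case using order_ge_mult[OF order_ge_1, of f n "f ^ n"] by simp
qed simp

lemma order_ge_prod:
  assumes "\<And>i. i \<in> I \<Longrightarrow> order_ge (k i) (f i)"
  shows "order_ge (\<Sum>i\<in>I. k i) (\<Prod>i\<in>I. f i)"
  using assms by (induction I rule: infinite_finite_induct) (auto intro: order_ge_mult)


section \<open>Substitution of power series\<close>

definition power_product :: "('y \<Rightarrow> 'b::comm_monoid_mult) \<Rightarrow> ('y \<Rightarrow>\<^sub>0 nat) \<Rightarrow> 'b" where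
  "power_product g \<beta> = (\<Prod>i \<in> Poly_Mapping.keys \<beta>. g i ^ Poly_Mapping.lookup \<beta> i)"

lemma power_product_superset:
  assumes "finite V" "Poly_Mapping.keys \<beta> \<subseteq> V"
  shows "power_product g \<beta> = (\<Prod>i \<in> V. g i ^ Poly_Mapping.lookup \<beta> i)"
  unfolding power_product_def using assms
  by (intro prod.mono_neutral_left) (auto simp: in_keys_iff)

lemma power_product_add: "power_product g (\<beta> + \<gamma>) = power_product g \<beta> * power_product g \<gamma>"
proof -
  let ?V = "Poly_Mapping.keys \<beta> \<union> Poly_Mapping.keys \<gamma>"
  show ?thesis
    using power_product_superset[of ?V \<beta> g] power_product_superset[of ?V \<gamma> g]
      power_product_superset[of ?V "\<beta> + \<gamma>" g] keys_add[of \<beta> \<gamma>]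
    by (simp add: lookup_add power_add prod.distrib)
qed

lemma coeff_subst:
  "coeff (subst g Q) \<alpha> = (\<Sum>\<beta>. coeff Q \<beta> * coeff (power_product g \<beta>) \<alpha>)"
  by (simp add: subst_def power_product_def)

lemma coeff_power_product_eq_0:
  assumes "\<forall>i \<in> A. g i \<in> max_ideal" "Poly_Mapping.keys \<beta> \<subseteq> A" "mdeg \<alpha> < mdeg \<beta>"
  shows "coeff (power_product g \<beta>) \<alpha> = 0"
proof -
  have "order_ge (mdeg \<beta>) (power_product g \<beta>)"
    unfolding mdeg_def power_product_def using assms(1,2)
    by (intro order_ge_prod order_ge_power) auto
  thus ?thesis using assms(3) by (simp add: order_ge_def)
qed

lemma coeff_subst_finite:
  assumes "finite A" "\<forall>i \<in> A. g i \<in> max_ideal" "vars_in A Q" "mdeg \<alpha> \<le> d"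
  shows "coeff (subst g Q) \<alpha> =
    (\<Sum>\<beta> \<in> {\<beta>. Poly_Mapping.keys \<beta> \<subseteq> A \<and> mdeg \<beta> \<le> d}. coeff Q \<beta> * coeff (power_product g \<beta>) \<alpha>)"
  unfolding coeff_subst
proof (rule Sum_any.expand_superset[OF finite_bounded_degree[OF assms(1)]], safe)
  fix \<beta>
  assume nz: "coeff Q \<beta> * coeff (power_product g \<beta>) \<alpha> \<noteq> 0"
  hence "coeff Q \<beta> \<noteq> 0" by auto
  with assms(3) show keys: "x \<in> A" if "x \<in> Poly_Mapping.keys \<beta>" for x
    using that by (auto simp: vars_in_def)
  show "mdeg \<beta> \<le> d"
  proof (rule ccontr)
    assume "\<not> mdeg \<beta> \<le> d"
    hence "coeff (power_product g \<beta>) \<alpha> = 0"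
      using keys assms(4) by (intro coeff_power_product_eq_0[OF assms(2)]) auto
    with nz show False by simp
  qed
qed

lemma coeff_subst_cong:
  assumes "\<forall>i \<in> A. g i \<in> max_ideal" "vars_in A P" "vars_in A Q"
    and "\<And>\<beta>. mdeg \<beta> \<le> mdeg \<alpha> \<Longrightarrow> coeff P \<beta> = coeff Q \<beta>"
  shows "coeff (subst g P) \<alpha> = coeff (subst g Q) \<alpha>"
proof -
  have "coeff P \<beta> * coeff (power_product g \<beta>) \<alpha> = coeff Q \<beta> * coeff (power_product g \<beta>) \<alpha>" for \<beta>
  proof -
    consider "mdeg \<beta> \<le> mdeg \<alpha>" | "coeff P \<beta> = 0" "coeff Q \<beta> = 0"
      | "Poly_Mapping.keys \<beta> \<subseteq> A" "mdeg \<alpha> < mdeg \<beta>"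
      using assms(2,3) by (meson not_le vars_in_def)
    thus ?thesis
      using coeff_power_product_eq_0[OF assms(1), of \<beta> \<alpha>] by cases (simp_all add: assms(4))
  qed
  thus ?thesis by (simp add: coeff_subst)
qed

lemma coeff_subst_0:
  assumes "finite A" "\<forall>i \<in> A. g i \<in> max_ideal" "vars_in A Q"
  shows "coeff (subst g Q) 0 = coeff Q 0"
proof -
  have "{\<beta>. Poly_Mapping.keys \<beta> \<subseteq> A \<and> mdeg \<beta> \<le> 0} = {0}"
    by (auto simp: mdeg_eq_0_iff)
  thus ?thesis
    using coeff_subst_finite[OF assms, of 0 0] by (simp add: mdeg_def power_product_def)
qed

lemma vars_in_mult:
  assumes "vars_in A P" "vars_in A Q"
  shows "vars_in A (P * Q)"
  unfolding vars_in_def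
proof (intro allI impI)
  fix \<beta> assume "coeff (P * Q) \<beta> \<noteq> 0"
  then obtain a b where "a + b = \<beta>" "coeff P a * coeff Q b \<noteq> 0"
    unfolding coeff_mult by (auto elim: sum.not_neutral_contains_not_neutral)
  moreover from this have "coeff P a \<noteq> 0" "coeff Q b \<noteq> 0" by auto
  ultimately show "Poly_Mapping.keys \<beta> \<subseteq> A"
    using assms keys_add[of a b] unfolding vars_in_def by blast
qed

text \<open>
  Only exponents of degree at most \<open>deg \<alpha>\<close> contribute to the coefficient at \<open>\<alpha>\<close>, on both sides, so
  the claim reduces to exchanging finite sums.  The pairs \<open>(\<beta>, \<gamma>)\<close> needed on the left are those with
  \<open>deg (\<beta> + \<gamma>) \<le> deg \<alpha>\<close>; on the right both degrees are bounded separately, and the additional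
  pairs contribute \<open>0\<close>.
\<close>

lemma subst_mult:
  fixes g :: "'y \<Rightarrow> ('x, 'a::comm_ring_1) mfps"
  assumes "finite A" "\<forall>i \<in> A. g i \<in> max_ideal" "vars_in A P" "vars_in A Q"
  shows "subst g (P * Q) = subst g P * subst g Q"
proof (rule mfps_eqI)
  fix \<alpha> :: "'x \<Rightarrow>\<^sub>0 nat"
  let ?B = "{\<beta>. Poly_Mapping.keys \<beta> \<subseteq> A \<and> mdeg \<beta> \<le> mdeg \<alpha>}"
  let ?m = "power_product g"
  let ?t = "\<lambda>(\<beta>, \<gamma>). coeff P \<beta> * coeff Q \<gamma> * coeff (?m (\<beta> + \<gamma>)) \<alpha>"
  let ?C = "{(\<beta>, \<gamma>). Poly_Mapping.keys (\<beta> + \<gamma>) \<subseteq> A \<and> mdeg (\<beta> + \<gamma>) \<le> mdeg \<alpha>}"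
  note finB = finite_bounded_degree[OF assms(1), of "mdeg \<alpha>"]
  have keys: "Poly_Mapping.keys (\<beta> + \<gamma>) = Poly_Mapping.keys \<beta> \<union> Poly_Mapping.keys \<gamma>"
    for \<beta> \<gamma> :: "'y \<Rightarrow>\<^sub>0 nat"
    by (auto simp: in_keys_iff lookup_add)
  have "coeff (subst g (P * Q)) \<alpha>
      = (\<Sum>\<delta> \<in> ?B. \<Sum>\<beta>\<gamma> \<in> {(\<beta>, \<gamma>). \<beta> + \<gamma> = \<delta>}. ?t \<beta>\<gamma>)"
    unfolding coeff_subst_finite[OF assms(1,2) vars_in_mult[OF assms(3,4)] order_refl] coeff_mult
    by (auto simp: sum_distrib_right intro!: sum.cong)
  also have "\<dots> = (\<Sum>\<beta>\<gamma> \<in> ?C. ?t \<beta>\<gamma>)"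
    by (subst sum.Sigma, rule finB, intro ballI finite_splits)
       (rule sum.reindex_bij_witness[where i = "\<lambda>(\<beta>, \<gamma>). (\<beta> + \<gamma>, (\<beta>, \<gamma>))" and j = snd], auto)
  also have "\<dots> = (\<Sum>\<beta>\<gamma> \<in> ?B \<times> ?B. ?t \<beta>\<gamma>)"
  proof (rule sum.mono_neutral_left)
    show "\<forall>\<beta>\<gamma> \<in> ?B \<times> ?B - ?C. ?t \<beta>\<gamma> = 0"
    proof
      fix p assume p: "p \<in> ?B \<times> ?B - ?C"
      obtain \<beta> \<gamma> where "p = (\<beta>, \<gamma>)" by (cases p)
      moreover from this p have "coeff (?m (\<beta> + \<gamma>)) \<alpha> = 0"
        by (intro coeff_power_product_eq_0[OF assms(2)]) (auto simp: keys)
      ultimately show "?t p = 0" by simp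
    qed
  qed (use finB in \<open>auto simp: keys mdeg_add\<close>)
  also have "\<dots> = (\<Sum>\<beta> \<in> ?B. \<Sum>\<gamma> \<in> ?B. \<Sum>(a, b) \<in> {(a, b). a + b = \<alpha>}.
      (coeff P \<beta> * coeff (?m \<beta>) a) * (coeff Q \<gamma> * coeff (?m \<gamma>) b))"
    unfolding sum.cartesian_product[symmetric]
    by (simp add: power_product_add coeff_mult sum_distrib_left
        case_prod_beta mult_ac)
  also have "\<dots> = (\<Sum>(a, b) \<in> {(a, b). a + b = \<alpha>}. \<Sum>\<beta> \<in> ?B. \<Sum>\<gamma> \<in> ?B.
      (coeff P \<beta> * coeff (?m \<beta>) a) * (coeff Q \<gamma> * coeff (?m \<gamma>) b))"
    unfolding case_prod_beta
    by (subst (2) sum.swap, subst sum.swap) (rule refl)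
  also have "\<dots> = (\<Sum>(a, b) \<in> {(a, b). a + b = \<alpha>}. coeff (subst g P) a * coeff (subst g Q) b)"
  proof (rule sum.cong[OF refl], clarify)
    fix a b assume "\<alpha> = a + b"
    hence "mdeg a \<le> mdeg \<alpha>" "mdeg b \<le> mdeg \<alpha>" by (simp_all add: mdeg_add)
    thus "(\<Sum>\<beta> \<in> {\<beta>. Poly_Mapping.keys \<beta> \<subseteq> A \<and> mdeg \<beta> \<le> mdeg (a + b)}.
        \<Sum>\<gamma> \<in> {\<beta>. Poly_Mapping.keys \<beta> \<subseteq> A \<and> mdeg \<beta> \<le> mdeg (a + b)}.
          (coeff P \<beta> * coeff (?m \<beta>) a) * (coeff Q \<gamma> * coeff (?m \<gamma>) b))
        = coeff (subst g P) a * coeff (subst g Q) b"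
      using \<open>\<alpha> = a + b\<close>
      by (simp only: coeff_subst_finite[OF assms(1,2,3)] coeff_subst_finite[OF assms(1,2,4)]
          sum_product)
  qed
  also have "\<dots> = coeff (subst g P * subst g Q) \<alpha>"
    by (simp add: coeff_mult)
  finally show "coeff (subst g (P * Q)) \<alpha> = coeff (subst g P * subst g Q) \<alpha>" .
qed

lemma subst_1: "subst g 1 = 1"
proof (rule mfps_eqI)
  fix \<alpha>
  have "coeff (subst g 1) \<alpha> = (\<Sum>\<beta> \<in> {0}. coeff 1 \<beta> * coeff (power_product g \<beta>) \<alpha>)"
    unfolding coeff_subst by (rule Sum_any.expand_superset) (auto split: if_splits)
  thus "coeff (subst g 1) \<alpha> = coeff 1 \<alpha>" by (simp add: power_product_def)
qed

text \<open>
  In the recursion for the coefficient of \<open>1 / Q\<close> at \<open>m\<close>, a variable of \<open>m\<close> outside \<open>A\<close> occurs in one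
  of the two factors of every product, which makes that factor vanish.
\<close>

lemma vars_in_inverse: "vars_in A Q \<Longrightarrow> vars_in A (Abs_mfps (inv_coeff Q))"
proof -
  assume Q: "vars_in A Q"
  have "inv_coeff Q m = 0" if "\<not> Poly_Mapping.keys m \<subseteq> A" for m
    using that
  proof (induction "mdeg m" arbitrary: m rule: less_induct)
    case less
    hence "m \<noteq> 0" by auto
    have "coeff Q a * inv_coeff Q b = 0" if "a + b = m" "a \<noteq> 0" for a b
    proof (cases "Poly_Mapping.keys a \<subseteq> A")
      case True
      with that less.prems keys_add[of a b] have "\<not> Poly_Mapping.keys b \<subseteq> A" by auto
      moreover have "mdeg b < mdeg m"
        using that by (auto simp: mdeg_add mdeg_eq_0_iff neq0_conv[symmetric])
      ultimately show ?thesis using less.hyps by simp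
    next
      case False
      with Q show ?thesis by (auto simp: vars_in_def)
    qed
    thus ?case
      using \<open>m \<noteq> 0\<close> by (subst inv_coeff.simps) (auto intro!: sum.neutral)
  qed
  thus ?thesis by (auto simp: vars_in_def)
qed


section \<open>Polynomials\<close>

lemma one_in_polynomials [simp]: "(1 :: ('x, 'a::comm_ring_1) mfps) \<in> polynomials"
  by (simp add: polynomials_iff)

lemma polynomials_mult:
  "f \<in> polynomials \<Longrightarrow> h \<in> polynomials \<Longrightarrow> f * h \<in> (polynomials :: ('x, 'a::comm_ring_1) mfps set)"
  by (auto simp: polynomials_def of_poly_hom(3)[symmetric])

lemma polynomials_power: "f \<in> polynomials \<Longrightarrow> f ^ n \<in> polynomials"
  by (induction n) (auto intro: polynomials_mult)

lemma polynomials_prod: "(\<And>i. i \<in> I \<Longrightarrow> f i \<in> polynomials) \<Longrightarrow> (\<Prod>i\<in>I. f i) \<in> polynomials"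
  by (induction I rule: infinite_finite_induct) (auto intro: polynomials_mult)

lemma poly_alg_subset_polynomials:
  assumes "\<forall>i \<in> {1..s}. g i \<in> polynomials"
  shows "poly_alg s g \<subseteq> polynomials"
proof
  fix f assume "f \<in> poly_alg s g"
  then obtain Q where Q: "f = subst g Q" "Q \<in> polynomials" "vars_in {1..s} Q"
    by (auto simp: poly_alg_def)
  let ?supp = "\<Union>\<beta> \<in> {\<beta>. coeff Q \<beta> \<noteq> 0}. {\<alpha>. coeff (power_product g \<beta>) \<alpha> \<noteq> 0}"
  have "power_product g \<beta> \<in> polynomials" if "coeff Q \<beta> \<noteq> 0" for \<beta>
    unfolding power_product_def using that Q(3) assms
    by (intro polynomials_prod polynomials_power) (auto simp: vars_in_def)
  hence "finite ?supp"
    using Q(2) by (auto simp: polynomials_iff)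
  moreover have "{\<alpha>. coeff f \<alpha> \<noteq> 0} \<subseteq> ?supp"
  proof
    fix \<alpha> assume "\<alpha> \<in> {\<alpha>. coeff f \<alpha> \<noteq> 0}"
    then obtain \<beta> where "coeff Q \<beta> * coeff (power_product g \<beta>) \<alpha> \<noteq> 0"
      unfolding Q(1) coeff_subst by (auto elim: Sum_any.not_neutral_obtains_not_neutral)
    hence "coeff Q \<beta> \<noteq> 0" "coeff (power_product g \<beta>) \<alpha> \<noteq> 0" by auto
    thus "\<alpha> \<in> ?supp" by blast
  qed
  ultimately show "f \<in> polynomials"
    unfolding polynomials_iff by (rule rev_finite_subset)
qed


section \<open>Leading monomials for a local degree ordering\<close>

locale local_degree_order =
  fixes gt :: "('x \<Rightarrow>\<^sub>0 nat) \<Rightarrow> ('x \<Rightarrow>\<^sub>0 nat) \<Rightarrow> bool"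
  assumes local_degree: "local_degree_ordering gt"
begin

lemma irrefl: "\<not> gt \<alpha> \<alpha>"
  and trans: "gt \<alpha> \<beta> \<Longrightarrow> gt \<beta> \<gamma> \<Longrightarrow> gt \<alpha> \<gamma>"
  and total: "\<alpha> \<noteq> \<beta> \<Longrightarrow> gt \<alpha> \<beta> \<or> gt \<beta> \<alpha>"
  and add_mono: "gt \<alpha> \<beta> \<Longrightarrow> gt (\<gamma> + \<alpha>) (\<gamma> + \<beta>)"
  using local_degree
  unfolding local_degree_ordering_def local_ordering_def monomial_ordering_def
  by (auto dest: irreflpD transpD totalpD)

lemma gt_if_mdeg_less: "mdeg \<alpha> < mdeg \<beta> \<Longrightarrow> gt \<alpha> \<beta>"
  using local_degree total[of \<alpha> \<beta>] unfolding local_degree_ordering_def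
  by (metis leD less_irrefl)

text \<open>
  The relational form of \<^const>\<open>LM\<close>: it asserts that a largest monomial exists, which the definite
  description in \<^const>\<open>LM\<close> leaves open.
\<close>

definition is_LM :: "('x, 'a::zero) mfps \<Rightarrow> ('x \<Rightarrow>\<^sub>0 nat) \<Rightarrow> bool" where
  "is_LM f \<alpha> \<longleftrightarrow> coeff f \<alpha> \<noteq> 0 \<and> (\<forall>\<beta>. coeff f \<beta> \<noteq> 0 \<and> \<beta> \<noteq> \<alpha> \<longrightarrow> gt \<alpha> \<beta>)"

lemma is_LM_imp_LM_eq: "is_LM f \<alpha> \<Longrightarrow> LM gt f = \<alpha>"
  unfolding LM_def is_LM_def using irrefl trans by (intro the_equality) (auto, metis)

lemma finite_has_greatest:
  assumes "finite A" "A \<noteq> {}"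
  shows "\<exists>\<alpha> \<in> A. \<forall>\<beta> \<in> A. \<beta> \<noteq> \<alpha> \<longrightarrow> gt \<alpha> \<beta>"
  using assms
proof (induction rule: finite_ne_induct)
  case (insert x F)
  then obtain \<alpha> where "\<alpha> \<in> F" "\<forall>\<beta> \<in> F. \<beta> \<noteq> \<alpha> \<longrightarrow> gt \<alpha> \<beta>" by blast
  thus ?case using total[of \<alpha> x] trans by (metis insert_iff)
qed auto

text \<open>
  A power series has infinitely many terms, but only those of lowest degree compete for the leading
  monomial, and in finitely many variables these are finite in number.
\<close>

lemma is_LM_LM:
  fixes f :: "('x, 'a::comm_ring_1) mfps"
  assumes "finite (UNIV :: 'x set)" "f \<noteq> 0"
  shows "is_LM f (LM gt f)"
proof -
  obtain \<gamma> where \<gamma>: "coeff f \<gamma> \<noteq> 0" "\<And>\<beta>. coeff f \<beta> \<noteq> 0 \<Longrightarrow> mdeg \<gamma> \<le> mdeg \<beta>"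
    using assms(2) ex_has_least_nat[of "\<lambda>\<beta>. coeff f \<beta> \<noteq> 0" _ mdeg]
    by (metis coeff_simps(1) mfps_eqI)
  let ?A = "{\<alpha>. coeff f \<alpha> \<noteq> 0 \<and> mdeg \<alpha> \<le> mdeg \<gamma>}"
  have "finite ?A" "?A \<noteq> {}"
    using \<gamma> finite_subset[OF _ finite_bounded_degree[OF assms(1), of "mdeg \<gamma>"], of ?A] by auto
  then obtain \<alpha> where \<alpha>: "\<alpha> \<in> ?A" "\<forall>\<beta> \<in> ?A. \<beta> \<noteq> \<alpha> \<longrightarrow> gt \<alpha> \<beta>"
    using finite_has_greatest by blast
  have "gt \<alpha> \<beta>" if "coeff f \<beta> \<noteq> 0" "\<beta> \<noteq> \<alpha>" for \<beta>
    using \<alpha> that gt_if_mdeg_less[of \<alpha> \<beta>] by (cases "mdeg \<beta> \<le> mdeg \<gamma>") auto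
  with \<alpha> have "is_LM f \<alpha>" by (auto simp: is_LM_def)
  thus ?thesis using is_LM_imp_LM_eq by metis
qed

text \<open>
  The product of the leading terms cannot cancel: a product of any other two terms is strictly
  smaller.
\<close>

lemma is_LM_mult:
  fixes f h :: "('x, 'a::idom) mfps"
  assumes f: "is_LM f \<alpha>" and h: "is_LM h \<beta>"
  shows "is_LM (f * h) (\<alpha> + \<beta>)"
proof -
  have less: "gt (\<alpha> + \<beta>) (a + b)"
    if "coeff f a * coeff h b \<noteq> 0" "(a, b) \<noteq> (\<alpha>, \<beta>)" for a b
  proof -
    have "a = \<alpha> \<or> gt \<alpha> a" "b = \<beta> \<or> gt \<beta> b"
      using that f h by (auto simp: is_LM_def)
    hence "a = \<alpha> \<or> gt (\<alpha> + \<beta>) (a + \<beta>)" "b = \<beta> \<or> gt (a + \<beta>) (a + b)"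
      using add_mono[of \<alpha> a \<beta>] add_mono[of \<beta> b a] by (auto simp: add.commute)
    thus ?thesis using that(2) trans by auto
  qed
  have "coeff (f * h) (\<alpha> + \<beta>) = (\<Sum>(a, b) \<in> {(\<alpha>, \<beta>)}. coeff f a * coeff h b)"
    unfolding coeff_mult
  proof (rule sum.mono_neutral_right[OF finite_splits])
    show "\<forall>ab \<in> {(a, b). a + b = \<alpha> + \<beta>} - {(\<alpha>, \<beta>)}. (case ab of (a, b) \<Rightarrow> coeff f a * coeff h b) = 0"
      using less irrefl by (clarsimp, metis mult_eq_0_iff prod.inject)
  qed auto
  hence "coeff (f * h) (\<alpha> + \<beta>) \<noteq> 0"
    using f h by (simp add: is_LM_def)
  moreover have "gt (\<alpha> + \<beta>) \<gamma>" if nz: "coeff (f * h) \<gamma> \<noteq> 0" and ne: "\<gamma> \<noteq> \<alpha> + \<beta>" for \<gamma>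
  proof -
    obtain a b where "a + b = \<gamma>" "coeff f a * coeff h b \<noteq> 0"
      using nz unfolding coeff_mult by (auto elim: sum.not_neutral_contains_not_neutral)
    thus ?thesis using less ne by auto
  qed
  ultimately show ?thesis by (auto simp: is_LM_def)
qed

text \<open>
  This is where a degree ordering is essential: changing terms of high degree cannot create a new
  leading term.
\<close>

lemma LM_cong_upto_degree:
  assumes "is_LM f \<alpha>" and "\<And>\<beta>. mdeg \<beta> \<le> mdeg \<alpha> \<Longrightarrow> coeff h \<beta> = coeff f \<beta>"
  shows "is_LM h \<alpha>"
  unfolding is_LM_def
proof (intro conjI allI impI)
  fix \<beta> assume \<beta>: "coeff h \<beta> \<noteq> 0 \<and> \<beta> \<noteq> \<alpha>"
  show "gt \<alpha> \<beta>"
  proof (cases "mdeg \<beta> \<le> mdeg \<alpha>")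
    case True
    with \<beta> assms show ?thesis by (simp add: is_LM_def)
  qed (simp add: gt_if_mdeg_less)
qed (use assms in \<open>simp add: is_LM_def\<close>)


section \<open>Localizations and subalgebras\<close>

context
  assumes finite_vars: "finite (UNIV :: 'x set)"
begin

lemma loc_units_iff:
  fixes u :: "('x, 'a::comm_ring_1) mfps"
  shows "u \<in> loc_units gt \<longleftrightarrow> u \<in> polynomials \<and> is_LM u 0"
proof -
  have "u \<noteq> 0" if "is_LM u 0" using that by (auto simp: is_LM_def)
  thus ?thesis
    using is_LM_LM[OF finite_vars, of u] by (auto simp: loc_units_def dest: is_LM_imp_LM_eq)
qed

lemma LM_loc_eq_LM:
  fixes f :: "('x, 'a::idom) mfps"
  assumes "f \<in> loc_polynomials gt" "f \<noteq> 0"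
  shows "LM_loc gt f = LM gt f"
proof -
  let ?u = "SOME u. u \<in> loc_units gt \<and> u * f \<in> polynomials"
  have "\<exists>u. u \<in> loc_units gt \<and> u * f \<in> polynomials"
    using assms(1) by (auto simp: loc_polynomials_def fractions_def)
  hence "?u \<in> loc_units gt \<and> ?u * f \<in> polynomials" by (rule someI_ex)
  hence "is_LM (?u * f) (0 + LM gt f)"
    by (intro is_LM_mult is_LM_LM finite_vars assms) (simp add: loc_units_iff)
  thus ?thesis by (simp add: LM_loc_def is_LM_imp_LM_eq)
qed

lemma polynomials_subset_loc_polynomials:
  "polynomials \<subseteq> (loc_polynomials gt :: ('x, 'a::comm_ring_1) mfps set)"
proof -
  have "(1 :: ('x, 'a) mfps) \<in> loc_units gt"
    by (auto simp: loc_units_iff is_LM_def)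
  thus ?thesis by (force simp: loc_polynomials_def fractions_def)
qed

lemma loc_polynomials_mult:
  fixes f h :: "('x, 'a::idom) mfps"
  assumes "f \<in> loc_polynomials gt" "h \<in> loc_polynomials gt"
  shows "f * h \<in> loc_polynomials gt"
proof -
  obtain u v where uv: "u \<in> loc_units gt" "v \<in> loc_units gt"
      "u * f \<in> polynomials" "v * h \<in> polynomials"
    using assms by (auto simp: loc_polynomials_def fractions_def)
  hence "u * v \<in> loc_units gt"
    using is_LM_mult[of u 0 v 0] by (auto simp: loc_units_iff intro: polynomials_mult)
  moreover have "(u * f) * (v * h) \<in> polynomials"
    using uv by (auto intro: polynomials_mult)
  hence "(u * v) * (f * h) \<in> polynomials"
    by (simp add: mult_ac)
  ultimately show ?thesis by (auto simp: loc_polynomials_def fractions_def)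
qed

lemma power_products_subset_loc_polynomials:
  fixes S :: "('x, 'a::idom) mfps set"
  assumes "S \<subseteq> loc_polynomials gt"
  shows "power_products S \<subseteq> loc_polynomials gt"
proof -
  have one: "(1 :: ('x, 'a) mfps) \<in> loc_polynomials gt"
    using polynomials_subset_loc_polynomials one_in_polynomials by blast
  have pow: "f ^ n \<in> loc_polynomials gt" if "f \<in> loc_polynomials gt" for f :: "('x, 'a) mfps" and n
    using that by (induction n) (auto intro: one loc_polynomials_mult)
  have prod: "(\<Prod>i\<in>I. f i) \<in> loc_polynomials gt" if "\<And>i. i \<in> I \<Longrightarrow> f i \<in> loc_polynomials gt"
    for I :: "nat set" and f :: "nat \<Rightarrow> ('x, 'a) mfps"
    using that by (induction I rule: infinite_finite_induct) (auto intro: one loc_polynomials_mult)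
  show ?thesis
  proof
    fix p assume "p \<in> power_products S"
    then obtain m n and t :: "nat \<Rightarrow> ('x, 'a) mfps"
      where "p = (\<Prod>i = 1..m. t i ^ n i)" "\<forall>i \<in> {1..m}. t i \<in> S"
      unfolding power_products_def by blast
    thus "p \<in> loc_polynomials gt"
      using assms by (auto intro!: prod pow)
  qed
qed

lemma poly_alg_subset_loc_alg:
  fixes g :: "nat \<Rightarrow> ('x, 'a::comm_ring_1) mfps"
  shows "poly_alg s g \<subseteq> loc_alg gt s g"
proof -
  have "vars_in {1..s} (1 :: (nat, 'a) mfps)" by (auto simp: vars_in_def split: if_splits)
  hence "(1 :: ('x, 'a) mfps) \<in> poly_alg s g"
    unfolding poly_alg_def using subst_1[of g] by (force intro: exI[of _ 1])
  moreover have "(1 :: ('x, 'a) mfps) \<in> loc_units gt"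
    by (auto simp: loc_units_iff is_LM_def)
  ultimately show ?thesis by (force simp: loc_alg_def fractions_def)
qed

text \<open>
  The denominators of \<open>K[G]\<^sub>>\<close> are invertible in \<open>K[[G]]\<close> itself, because the substitution preserves
  constant terms: the inverse can be taken before substituting.
\<close>

lemma loc_alg_subset_power_series_alg:
  fixes g :: "nat \<Rightarrow> ('x, 'a::field) mfps"
  assumes "\<forall>i \<in> {1..s}. g i \<in> max_ideal"
  shows "loc_alg gt s g \<subseteq> power_series_alg s g"
proof
  fix h assume "h \<in> loc_alg gt s g"
  then obtain U F where U: "subst g U \<in> loc_units gt" "vars_in {1..s} U"
      and F: "vars_in {1..s} F" "subst g U * h = subst g F"
    by (auto simp: loc_alg_def fractions_def poly_alg_def)
  let ?V = "Abs_mfps (inv_coeff U)"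
  note mult = subst_mult[OF finite_atLeastAtMost assms]
  have V: "vars_in {1..s} ?V" using U(2) by (rule vars_in_inverse)
  have "coeff U 0 \<noteq> 0"
    using U coeff_subst_0[OF finite_atLeastAtMost assms U(2)] by (simp add: loc_units_iff is_LM_def)
  hence "subst g ?V * subst g U = 1"
    using mult[OF V U(2)] mult_inv_coeff[of U] subst_1[of g] by (simp add: mult.commute)
  hence "h = subst g (?V * F)"
    using mult[OF V F(1)] F(2) by (metis mult.assoc mult_1)
  thus "h \<in> power_series_alg s g"
    using vars_in_mult[OF V F(1)] by (auto simp: power_series_alg_def)
qed

text \<open>
  The leading monomial only sees terms up to its own degree, and these are determined by the
  truncation of \<open>Q\<close> at that degree.
\<close>

lemma power_series_alg_LM_in_poly_alg:
  fixes g :: "nat \<Rightarrow> ('x, 'a::comm_ring_1) mfps"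
  assumes "\<forall>i \<in> {1..s}. g i \<in> max_ideal" "f \<in> power_series_alg s g" "f \<noteq> 0"
  obtains f' where "f' \<in> poly_alg s g" "f' \<noteq> 0" "LM gt f' = LM gt f"
proof -
  obtain Q where Q: "f = subst g Q" "vars_in {1..s} Q"
    using assms(2) by (auto simp: power_series_alg_def)
  let ?\<alpha> = "LM gt f"
  define Q' where "Q' = Abs_mfps (\<lambda>\<beta>. if mdeg \<beta> \<le> mdeg ?\<alpha> then coeff Q \<beta> else 0)"
  have Q': "vars_in {1..s} Q'"
    using Q(2) by (auto simp: vars_in_def Q'_def)
  have "{\<beta>. coeff Q' \<beta> \<noteq> 0} \<subseteq> {\<beta>. Poly_Mapping.keys \<beta> \<subseteq> {1..s} \<and> mdeg \<beta> \<le> mdeg ?\<alpha>}"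
    using Q(2) by (auto simp: vars_in_def Q'_def split: if_splits)
  hence "Q' \<in> polynomials"
    unfolding polynomials_iff by (rule finite_subset) (rule finite_bounded_degree, simp)
  with Q' have "subst g Q' \<in> poly_alg s g" by (auto simp: poly_alg_def)
  moreover have "coeff (subst g Q') \<beta> = coeff f \<beta>" if "mdeg \<beta> \<le> mdeg ?\<alpha>" for \<beta>
    unfolding Q(1) using that
    by (intro coeff_subst_cong[OF assms(1) Q' Q(2)]) (auto simp: Q'_def Q(1)[symmetric])
  hence "is_LM (subst g Q') ?\<alpha>"
    by (intro LM_cong_upto_degree[OF is_LM_LM[OF finite_vars assms(3)]])
  ultimately show thesis
    by (intro that[of "subst g Q'"]) (auto simp: is_LM_imp_LM_eq, auto simp: is_LM_def)
qed

end

end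


section \<open>Sasbi bases\<close>

theorem theorem3p2:
  fixes gt :: "('n::finite \<Rightarrow>\<^sub>0 nat) \<Rightarrow> ('n \<Rightarrow>\<^sub>0 nat) \<Rightarrow> bool"
    and s :: nat
    and g :: "nat \<Rightarrow> ('n, 'k::field) mfps"
    and S :: "('n, 'k) mfps set"
  assumes "local_degree_ordering gt"
    and "\<forall>i \<in> {1..s}. g i \<in> polynomials \<and> g i \<noteq> 0 \<and> g i \<in> max_ideal"
    and "sasbi_basis (LM_loc gt) (loc_alg gt s g) S"
  shows "sasbi_basis (LM gt) (power_series_alg s g) S"
proof -
  interpret local_degree_order gt by (unfold_locales) (fact assms(1))
  have poly: "poly_alg s g \<subseteq> polynomials" and max: "\<forall>i \<in> {1..s}. g i \<in> max_ideal"
    using assms(2) by (auto intro!: poly_alg_subset_polynomials)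
  have S: "S \<subseteq> loc_alg gt s g"
    using assms(3) by (simp add: sasbi_basis_def)
  also have "\<dots> \<subseteq> loc_polynomials gt"
    using poly by (auto simp: loc_alg_def loc_polynomials_def fractions_def)
  finally have prods: "power_products S \<subseteq> loc_polynomials gt"
    by (rule power_products_subset_loc_polynomials[OF finite_UNIV])
  show ?thesis
    unfolding sasbi_basis_def
  proof (intro conjI ballI)
    show "S \<subseteq> power_series_alg s g"
      using S loc_alg_subset_power_series_alg[OF finite_UNIV max] by blast
  next
    fix f assume "f \<in> power_series_alg s g - {0}"
    then obtain f' where f': "f' \<in> poly_alg s g" "f' \<noteq> 0" "LM gt f' = LM gt f"
      using power_series_alg_LM_in_poly_alg[OF finite_UNIV max, of f] by blast
    then obtain p where p: "p \<in> power_products S" "p \<noteq> 0" "LM_loc gt f' = LM_loc gt p"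
      using assms(3) poly_alg_subset_loc_alg[OF finite_UNIV, of s g]
      unfolding sasbi_basis_def by blast
    have "f' \<in> loc_polynomials gt"
      using f'(1) poly polynomials_subset_loc_polynomials[OF finite_UNIV] by blast
    hence "LM gt f = LM gt p"
      using LM_loc_eq_LM[OF finite_UNIV] f' p prods by (metis subsetD)
    with p show "\<exists>p \<in> power_products S. p \<noteq> 0 \<and> LM gt f = LM gt p" by blast
  qed
qed

end
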